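(* Let $G$ be an infinite finitely generated group with finite generating set $S$. If there exists a positive real number $\beta$ such that $$|S|-1\ \ge\ \beta+\sum_{n\ge 0}\rho_n\beta^{1-n},$$ then $\mu(G,S)\ge\beta$, where $\rho_n$ is the number of self-avoiding polygons of length $n$.
   Context: All generating sets $S$ are finite, symmetric ($S=S^{-1}$) and do not contain the identity $1_G$. For $w\in S^*$, $\overline{w}\in G$ is the element represented by $w$. The Cayley graph $\Gamma(G,S)$ has vertex set $G$ and edges between $g$ and $gs$ ($g\in G$, $s\in S$). A self-avoiding polygon (SAP) is a word $w\in S^*$ with $\overline{w}=1_G$ that labels a simple cycle of $\Gamma(G,S)$ starting at $1_G$; equivalently, $w$ is a word of length at least $3$ with $\overline{w}=1_G$ such that no nonempty proper contiguous subword of $w$ represents $1_G$. $\rho_n$ is the number of such words of length $n$. The connective constant is $\mu(G,S)=\lim_{n\to\infty}\sqrt[n]{c_n}$, where $c_n$ is the number of self-avoiding walks (paths never visiting a vertex twice) of length $n$ in $\Gamma(G,S)$ starting at $1_G$. *)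

theory Defs
  imports Complex_Main "HOL-Algebra.Generated_Groups"
begin

definition word_val :: "('a, 'b) monoid_scheme \<Rightarrow> 'a list \<Rightarrow> 'a" where
  "word_val G w = foldr (\<otimes>\<^bsub>G\<^esub>) w \<one>\<^bsub>G\<^esub>"

definition cayley_adj :: "('a, 'b) monoid_scheme \<Rightarrow> 'a set \<Rightarrow> 'a \<Rightarrow> 'a \<Rightarrow> bool" where
  "cayley_adj G S g h \<longleftrightarrow> g \<in> carrier G \<and> (\<exists>s\<in>S. h = g \<otimes>\<^bsub>G\<^esub> s)"

text \<open>Walks are nonempty lists of vertices. As \<open>S\<close> is symmetric and omits the identity, the
  Cayley graph is simple, so a walk is determined by its vertices; its length is
  \<open>length vs - 1\<close>.\<close>

definition cayley_walk :: "('a, 'b) monoid_scheme \<Rightarrow> 'a set \<Rightarrow> 'a list \<Rightarrow> bool" where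
  "cayley_walk G S vs \<longleftrightarrow>
     vs \<noteq> [] \<and> set vs \<subseteq> carrier G \<and> successively (cayley_adj G S) vs"

definition saws :: "('a, 'b) monoid_scheme \<Rightarrow> 'a set \<Rightarrow> nat \<Rightarrow> 'a list set" where
  "saws G S n =
     {vs. cayley_walk G S vs \<and> hd vs = \<one>\<^bsub>G\<^esub> \<and> length vs = Suc n \<and> distinct vs}"

definition saw_count :: "('a, 'b) monoid_scheme \<Rightarrow> 'a set \<Rightarrow> nat \<Rightarrow> nat" where
  "saw_count G S n = card (saws G S n)"

definition connective_constant :: "('a, 'b) monoid_scheme \<Rightarrow> 'a set \<Rightarrow> real" where
  "connective_constant G S = lim (\<lambda>n. root n (real (saw_count G S n)))"

text \<open>A cycle is listed with its starting vertex repeated at the end; a simple cycle has at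
  least three edges, so that traversing one edge back and forth does not count.\<close>

definition simple_cycle :: "('a, 'b) monoid_scheme \<Rightarrow> 'a set \<Rightarrow> 'a list \<Rightarrow> bool" where
  "simple_cycle G S vs \<longleftrightarrow>
     cayley_walk G S vs \<and> length vs \<ge> 4 \<and> hd vs = last vs \<and> distinct (tl vs)"

definition labelled_walk :: "('a, 'b) monoid_scheme \<Rightarrow> 'a list \<Rightarrow> 'a list" where
  "labelled_walk G w = map (\<lambda>i. word_val G (take i w)) [0..<Suc (length w)]"

text \<open>Polygons are words, hence based at the identity and oriented.\<close>

definition saps :: "('a, 'b) monoid_scheme \<Rightarrow> 'a set \<Rightarrow> nat \<Rightarrow> 'a list set" where
  "saps G S n =
     {w. set w \<subseteq> S \<and> length w = n \<and> word_val G w = \<one>\<^bsub>G\<^esub> \<and>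
         simple_cycle G S (labelled_walk G w)}"

definition sap_count :: "('a, 'b) monoid_scheme \<Rightarrow> 'a set \<Rightarrow> nat \<Rightarrow> nat" where
  "sap_count G S n = card (saps G S n)"

end

theory Submission
  imports Defs
begin

text \<open>Write \<open>c n\<close> for the number of self-avoiding walks. Extend such a walk of length \<open>n\<close> by an
  arbitrary letter of \<open>S\<close>. Either the result is self-avoiding, or it undoes the last step, or it
  closes a polygon of some length \<open>k\<close> at the end of a self-avoiding walk of length \<open>n + 1 - k\<close>.
  Hence \<open>c n * card S \<le> c (n + 1) + c n + (\<Sum>k. \<rho> k * c (n + 1 - k))\<close>. If \<open>c (m + 1) \<ge> \<beta> * c m\<close> for
  all \<open>m < n\<close>, then \<open>c (n + 1 - k) \<le> \<beta> powi (1 - k) * c n\<close>, and the hypothesis on \<open>\<beta>\<close> gives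
  \<open>c (n + 1) \<ge> \<beta> * c n\<close>. So \<open>c n \<ge> \<beta> ^ n\<close>. The limit defining the connective constant exists by
  Fekete's lemma.\<close>

section \<open>Subadditive sequences and limits of roots\<close>

text \<open>The limit is the infimum of the quotients; the slope \<open>b\<close> keeps it finite.
  For the upper estimate, fix \<open>k\<close> with a quotient close to the infimum and divide
  \<open>n\<close> by \<open>k\<close> with remainder.\<close>

lemma fekete:
  fixes a :: "nat \<Rightarrow> real"
  assumes sub: "\<And>m n. a (m + n) \<le> a m + a n"
    and below: "\<And>n. real n * b \<le> a n"
  shows "convergent (\<lambda>n. a n / real n)"
proof -
  \<comment> \<open>The index 0 is left out: division by zero would put the value 0 into the set and
    could spoil the infimum.\<close>
  define A where "A = (\<lambda>n. a n / real n) ` {1..}"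
  have A_ne: "A \<noteq> {}" by (auto simp: A_def)
  have A_bdd: "bdd_below A"
    unfolding A_def using below by (intro bdd_belowI[of _ b]) (auto simp: field_simps)
  have mult: "a (q * k + r) \<le> real q * a k + a r" for q k r
  proof (induction q)
    case (Suc q)
    have "a (Suc q * k + r) \<le> a k + a (q * k + r)"
      using sub[of k "q * k + r"] by (simp add: add.assoc)
    with Suc show ?case by (simp add: algebra_simps)
  qed simp
  have "(\<lambda>n. a n / real n) \<longlonglongrightarrow> Inf A"
  proof (rule order_tendstoI)
    fix y assume "y < Inf A"
    have "Inf A \<le> a n / real n" if "n \<ge> 1" for n
      using that by (intro cInf_lower A_bdd) (auto simp: A_def)
    then have "\<forall>n\<ge>1. y < a n / real n"
      using \<open>y < Inf A\<close> by (meson less_le_trans)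
    then show "\<forall>\<^sub>F n in sequentially. y < a n / real n"
      using eventually_sequentially by blast
  next
    fix y assume "Inf A < y"
    then obtain k where k: "k \<ge> 1" "a k / real k < y"
      using cInf_lessD[OF A_ne] by (auto simp: A_def)
    define x where "x = a k / real k"
    \<comment> \<open>\<open>M\<close> bounds the excess over the line of slope \<open>x\<close> at
      the finitely many remainders, so the quotient at \<open>n\<close> exceeds \<open>x\<close> by
      at most \<open>M / n\<close>.\<close>
    define M where "M = Max ((\<lambda>r. a r - real r * x) ` {..<k})"
    have ak: "a k = real k * x" using k by (simp add: x_def)
    have le: "a n / real n \<le> x + M / real n" if "n \<ge> 1" for n
    proof -
      have "a (n mod k) - real (n mod k) * x \<le> M"
        unfolding M_def using k by (intro Max_ge) auto
      moreover have "a n \<le> real (n div k) * (real k * x) + a (n mod k)"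
        using mult[of "n div k" k "n mod k"] by (simp add: ak)
      moreover have "real n = real (n div k) * real k + real (n mod k)"
        by (metis div_mult_mod_eq of_nat_add of_nat_mult)
      ultimately have "a n \<le> real n * x + M"
        by (simp add: algebra_simps)
      with that show ?thesis by (simp add: field_simps)
    qed
    have "(\<lambda>n. x + M / real n) \<longlonglongrightarrow> x + 0"
      by (intro tendsto_intros lim_const_over_n)
    then have "\<forall>\<^sub>F n in sequentially. x + M / real n < y"
      using k by (intro order_tendstoD(2)) (auto simp: x_def)
    with eventually_ge_at_top[of 1] show "\<forall>\<^sub>F n in sequentially. a n / real n < y"
      by eventually_elim (use le in force)
  qed
  then show ?thesis by (rule convergentI)
qed

text \<open>Logarithms turn submultiplicativity into subadditivity. The exponential lower bound
  makes every \<open>c n\<close> positive and supplies the slope \<open>ln \<beta>\<close> for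
  \<open>fekete\<close>.\<close>

lemma convergent_root_of_submultiplicative:
  fixes c :: "nat \<Rightarrow> real"
  assumes sub: "\<And>m n. c (m + n) \<le> c m * c n"
    and "\<beta> > 0" and below: "\<And>n. \<beta> ^ n \<le> c n"
  shows "convergent (\<lambda>n. root n (c n))"
proof -
  have pos: "c n > 0" for n
    using below[of n] zero_less_power[OF \<open>\<beta> > 0\<close>, of n] by linarith
  have "convergent (\<lambda>n. ln (c n) / real n)"
  proof (rule fekete)
    show "ln (c (m + n)) \<le> ln (c m) + ln (c n)" for m n
      using ln_mono[OF sub[of m n] pos] by (simp add: ln_mult_pos pos)
    show "real n * ln \<beta> \<le> ln (c n)" for n
      using ln_mono[OF below[of n]] \<open>\<beta> > 0\<close> by (simp add: ln_realpow)
  qed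
  then obtain l where "(\<lambda>n. ln (c n) / real n) \<longlonglongrightarrow> l"
    by (auto simp: convergent_def)
  then have lim: "(\<lambda>n. exp (ln (c n) / real n)) \<longlonglongrightarrow> exp l"
    by (rule tendsto_exp)
  \<comment> \<open>At \<open>n = 0\<close> the two sides are 1 and 0, so the sequences agree only
    from 1 on.\<close>
  have "exp (ln (c n) / real n) = root n (c n)" if "n > 0" for n
  proof -
    have "root n (c n) = c n powr (1 / real n)"
      using that less_imp_le[OF pos] by (rule root_powr_inverse)
    also have "\<dots> = exp (ln (c n) / real n)"
      unfolding powr_def using pos[of n] by simp
    finally show ?thesis ..
  qed
  then have "\<forall>\<^sub>F n in sequentially. exp (ln (c n) / real n) = root n (c n)"
    by (intro eventually_sequentiallyI[of 1]) auto
  with lim have "(\<lambda>n. root n (c n)) \<longlonglongrightarrow> exp l"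
    by (rule Lim_transform_eventually)
  then show ?thesis by (rule convergentI)
qed

section \<open>Walks in the Cayley graph: translation, cutting and labels\<close>

locale cayley_graph = group G for G (structure) +
  fixes S :: "'a set"
  assumes S_closed: "S \<subseteq> carrier G" and finite_S: "finite S" and one_notin_S: "\<one> \<notin> S"
begin

text \<open>Concatenation of paths: left translation moves a path \<open>q\<close> from the identity
  to the end of \<open>p\<close>, and \<open>tl\<close> removes the shared vertex.\<close>

definition glue :: "'a list \<Rightarrow> 'a list \<Rightarrow> 'a list" where
  "glue p q = p @ tl (map (\<lambda>x. last p \<otimes> x) q)"

lemma cayley_walk_take:
  "cayley_walk G S vs \<Longrightarrow> cayley_walk G S (take (Suc j) vs)"
  unfolding cayley_walk_def successively_conv_nth by (auto dest: in_set_takeD)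

lemma cayley_walk_drop:
  "cayley_walk G S vs \<Longrightarrow> j < length vs \<Longrightarrow> cayley_walk G S (drop j vs)"
  unfolding cayley_walk_def successively_conv_nth by (auto dest: in_set_dropD)

text \<open>Edges are right multiplications, so left multiplications are graph
  automorphisms.\<close>

lemma cayley_walk_translate:
  assumes "cayley_walk G S vs" "g \<in> carrier G"
  shows "cayley_walk G S (map (\<lambda>x. g \<otimes> x) vs)"
proof -
  have "cayley_adj G S (g \<otimes> x) (g \<otimes> y)" if "cayley_adj G S x y" for x y
    using that assms(2) S_closed unfolding cayley_adj_def by (auto simp: m_assoc subset_iff)
  with assms show ?thesis
    unfolding cayley_walk_def successively_conv_nth by auto
qed

lemma inj_on_translate: "g \<in> carrier G \<Longrightarrow> inj_on (\<lambda>x. g \<otimes> x) (carrier G)"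
  by (simp add: inj_on_def)

lemma walk_nth_closed: "cayley_walk G S vs \<Longrightarrow> j < length vs \<Longrightarrow> vs ! j \<in> carrier G"
  unfolding cayley_walk_def by (auto dest: nth_mem)

text \<open>Every walk can be cut at any vertex, with the tail moved back to the identity. The
  counting bounds below come from the surjections this provides.\<close>

lemma glue_split:
  assumes "cayley_walk G S vs" "j < length vs"
  shows "vs = glue (take (Suc j) vs) (map (\<lambda>x. inv (vs ! j) \<otimes> x) (drop j vs))"
proof -
  have g: "vs ! j \<in> carrier G" using walk_nth_closed assms by blast
  have "map (\<lambda>x. vs ! j \<otimes> x) (map (\<lambda>x. inv (vs ! j) \<otimes> x) (drop j vs)) = drop j vs"
    unfolding map_map
  proof (rule map_idI)
    fix x assume "x \<in> set (drop j vs)"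
    then have "x \<in> carrier G" using assms(1) unfolding cayley_walk_def by (auto dest: in_set_dropD)
    with g show "((\<otimes>) (vs ! j) \<circ> (\<otimes>) (inv (vs ! j))) x = x"
      by (simp flip: m_assoc)
  qed
  moreover have "last (take (Suc j) vs) = vs ! j"
    using assms(2) by (simp add: take_Suc_conv_app_nth)
  ultimately have "glue (take (Suc j) vs) (map (\<lambda>x. inv (vs ! j) \<otimes> x) (drop j vs))
      = take (Suc j) vs @ tl (drop j vs)"
    by (simp add: glue_def)
  also have "\<dots> = vs" by (simp add: tl_drop drop_Suc[symmetric])
  finally show ?thesis ..
qed

lemma word_val_closed: "set w \<subseteq> carrier G \<Longrightarrow> word_val G w \<in> carrier G"
  by (induction w) (auto simp: word_val_def)

lemma labelled_walk_Nil: "labelled_walk G [] = [\<one>]"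
  by (simp add: labelled_walk_def word_val_def)

lemma labelled_walk_Cons:
  "labelled_walk G (s # w) = \<one> # map (\<lambda>x. s \<otimes> x) (labelled_walk G w)"
proof -
  have "[0..<Suc (length (s # w))] = 0 # map Suc [0..<Suc (length w)]"
    by (subst upt_conv_Cons) (simp_all only: zero_less_Suc map_Suc_upt length_Cons)
  then show ?thesis
    unfolding labelled_walk_def by (simp only:) (simp add: word_val_def)
qed

lemma set_labelled_walk:
  "set w \<subseteq> carrier G \<Longrightarrow> set (labelled_walk G w) \<subseteq> carrier G"
  by (induction w) (auto simp: labelled_walk_Nil labelled_walk_Cons)

lemma last_labelled_walk: "last (labelled_walk G w) = word_val G w"
  by (simp add: labelled_walk_def)

text \<open>Links the two encodings: walks are lists of vertices, polygons are words. The letters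
  are read off the edges; the starting vertex is factored out because labelled walks start at the
  identity.\<close>

lemma walk_is_labelled:
  assumes "cayley_walk G S vs"
  shows "\<exists>w. set w \<subseteq> S \<and> length vs = Suc (length w) \<and>
           vs = map (\<lambda>x. hd vs \<otimes> x) (labelled_walk G w)"
  using assms
proof (induction vs rule: induct_list012)
  case 1
  then show ?case by (simp add: cayley_walk_def)
next
  case (2 x)
  then show ?case
    by (intro exI[of _ "[]"]) (auto simp: labelled_walk_Nil cayley_walk_def)
next
  case (3 x y zs)
  then have "cayley_walk G S (y # zs)" and x: "x \<in> carrier G" and "cayley_adj G S x y"
    by (auto simp: cayley_walk_def)
  then obtain s where s: "s \<in> S" "y = x \<otimes> s" by (auto simp: cayley_adj_def)
  obtain w where w: "set w \<subseteq> S" "length (y # zs) = Suc (length w)"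
    "y # zs = map (\<lambda>z. y \<otimes> z) (labelled_walk G w)"
    using "3.IH"(2)[OF \<open>cayley_walk G S (y # zs)\<close>] by auto
  have "z \<in> carrier G" if "z \<in> set (labelled_walk G w)" for z
    using that set_labelled_walk w(1) S_closed by blast
  then have "map (\<lambda>z. x \<otimes> z) (labelled_walk G (s # w)) = x # map (\<lambda>z. y \<otimes> z) (labelled_walk G w)"
    using x s S_closed by (auto simp: labelled_walk_Cons m_assoc)
  with w s show ?case by (intro exI[of _ "s # w"]) auto
qed

section \<open>Finiteness and submultiplicativity of the counts\<close>

lemma finite_saps: "finite (saps G S n)"
  by (rule finite_subset[OF _ finite_lists_length_eq[OF finite_S, of n]]) (auto simp: saps_def)

lemma saws_0: "saws G S 0 = {[\<one>]}"
  by (auto simp: saws_def cayley_walk_def length_Suc_conv)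

lemma saw_take:
  assumes "cayley_walk G S vs" "hd vs = \<one>" "distinct (take (Suc j) vs)" "j < length vs"
  shows "take (Suc j) vs \<in> saws G S j"
  using assms cayley_walk_take[OF assms(1)] by (auto simp: saws_def hd_take)

text \<open>Cut at vertex \<open>m\<close>. Both pieces inherit distinctness, the second because
  translation is injective.\<close>

lemma saws_add_subset:
  "saws G S (m + n) \<subseteq> (\<lambda>(p, q). glue p q) ` (saws G S m \<times> saws G S n)"
proof
  fix vs assume "vs \<in> saws G S (m + n)"
  then have vs: "cayley_walk G S vs" "hd vs = \<one>" "length vs = Suc (m + n)" "distinct vs"
    by (auto simp: saws_def)
  have g: "vs ! m \<in> carrier G" using vs walk_nth_closed by simp
  let ?q = "map (\<lambda>x. inv (vs ! m) \<otimes> x) (drop m vs)"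
  have walk: "cayley_walk G S (drop m vs)" using vs cayley_walk_drop by simp
  have "inj_on (\<lambda>x. inv (vs ! m) \<otimes> x) (set (drop m vs))"
    using inj_on_translate[of "inv (vs ! m)"] g walk
    by (auto simp: cayley_walk_def intro: inj_on_subset)
  then have "?q \<in> saws G S n"
    using vs g cayley_walk_translate[OF walk, of "inv (vs ! m)"]
    by (auto simp: saws_def distinct_map hd_map hd_drop_conv_nth)
  moreover have "take (Suc m) vs \<in> saws G S m"
    using vs by (intro saw_take) auto
  moreover have "vs = glue (take (Suc m) vs) ?q"
    using vs by (intro glue_split) auto
  ultimately show "vs \<in> (\<lambda>(p, q). glue p q) ` (saws G S m \<times> saws G S n)"
    by force
qed

section \<open>Extending a self-avoiding walk by one letter\<close>

definition extensions :: "nat \<Rightarrow> 'a list set" where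
  "extensions n = (\<lambda>(vs, s). vs @ [last vs \<otimes> s]) ` (saws G S n \<times> S)"

lemma extension_walk:
  assumes "vs \<in> saws G S n" "s \<in> S"
  shows "cayley_walk G S (vs @ [last vs \<otimes> s])"
proof -
  have vs: "vs \<noteq> []" "set vs \<subseteq> carrier G" "successively (cayley_adj G S) vs"
    using assms by (auto simp: saws_def cayley_walk_def)
  then have "last vs \<in> carrier G" by auto
  with vs assms S_closed show ?thesis
    by (auto simp: cayley_walk_def successively_append_iff cayley_adj_def)
qed

lemma saws_Suc_subset: "saws G S (Suc n) \<subseteq> extensions n"
proof
  fix ws assume "ws \<in> saws G S (Suc n)"
  then have ws: "cayley_walk G S ws" "hd ws = \<one>" "length ws = Suc (Suc n)" "distinct ws"
    by (auto simp: saws_def)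
  have p: "take (Suc n) ws \<in> saws G S n" using ws by (intro saw_take) auto
  have "cayley_adj G S (ws ! n) (ws ! Suc n)"
    using ws by (auto simp: cayley_walk_def successively_conv_nth)
  then obtain s where s: "s \<in> S" "ws ! Suc n = ws ! n \<otimes> s" by (auto simp: cayley_adj_def)
  have "last (take (Suc n) ws) = ws ! n" using ws by (simp add: take_Suc_conv_app_nth)
  moreover have "ws = take (Suc n) ws @ [ws ! Suc n]"
    using ws take_Suc_conv_app_nth[of "Suc n" ws] by simp
  ultimately have "ws = take (Suc n) ws @ [last (take (Suc n) ws) \<otimes> s]" using s by simp
  with p s show "ws \<in> extensions n" unfolding extensions_def by force
qed

lemma finite_saws: "finite (saws G S n)"
proof (induction n)
  case (Suc n)
  then show ?case
    using finite_S by (intro finite_subset[OF saws_Suc_subset]) (auto simp: extensions_def)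
qed (simp add: saws_0)

lemma saw_count_add: "saw_count G S (m + n) \<le> saw_count G S m * saw_count G S n"
  unfolding saw_count_def card_cartesian_product[symmetric]
  by (intro surj_card_le[OF _ saws_add_subset] finite_cartesian_product finite_saws)

text \<open>By left cancellation, different letters lead to different new vertices.\<close>

lemma card_extensions: "card (extensions n) = saw_count G S n * card S"
proof -
  have "s = t" if "vs \<in> saws G S n" "s \<in> S" "t \<in> S" "last vs \<otimes> s = last vs \<otimes> t" for vs s t
  proof -
    have "last vs \<in> carrier G" using that by (auto simp: saws_def cayley_walk_def)
    with that S_closed show ?thesis by (metis Units_eq Units_l_cancel subsetD)
  qed
  then have "inj_on (\<lambda>(vs, s). vs @ [last vs \<otimes> s]) (saws G S n \<times> S)"
    by (auto simp: inj_on_def)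
  then show ?thesis
    by (simp add: extensions_def card_image card_cartesian_product saw_count_def)
qed

text \<open>The loop from vertex \<open>j\<close> back to itself has \<open>n + 1 - j\<close> edges,
  at least three by the bound on \<open>j\<close>. Translating it by the inverse of vertex
  \<open>j\<close> bases it at the identity, where some word labels it.\<close>

lemma closing_extension:
  assumes vs: "vs \<in> saws G S n" and "s \<in> S" and j: "j + 2 \<le> n" and "last vs \<otimes> s = vs ! j"
  shows "vs @ [last vs \<otimes> s]
           \<in> (\<lambda>(p, w). glue p (labelled_walk G w)) ` (saws G S j \<times> saps G S (n + 1 - j))"
proof -
  let ?ws = "vs @ [last vs \<otimes> s]"
  define g where "g = vs ! j"
  have walk: "cayley_walk G S ?ws" using extension_walk assms by blast
  have props: "hd vs = \<one>" "length vs = Suc n" "distinct vs" "vs \<noteq> []" "set vs \<subseteq> carrier G"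
    using vs by (auto simp: saws_def cayley_walk_def)
  have g: "g \<in> carrier G" "?ws ! j = g"
    using props j by (auto simp: g_def nth_append)
  define D where "D = drop j ?ws"
  define q where "q = map (\<lambda>x. inv g \<otimes> x) D"
  have D: "D = drop j vs @ [g]" "length D = n + 2 - j"
    using props j assms(4) by (auto simp: D_def g_def)
  have Dhd: "hd D = g" using D(1) props j by (simp add: hd_append hd_drop_conv_nth g_def)
  have Dwalk: "cayley_walk G S D"
    unfolding D_def using props j by (intro cayley_walk_drop[OF walk]) auto
  have qwalk: "cayley_walk G S q"
    unfolding q_def using g Dwalk by (intro cayley_walk_translate) auto
  \<comment> \<open>Vertex \<open>j\<close> occurs at both ends of \<open>D\<close>; removing the
    first occurrence leaves a list without repetitions.\<close>
  have "tl D = drop (Suc j) vs @ [g]"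
    using D(1) props j by (simp add: drop_Suc tl_drop)
  moreover have "g \<notin> set (drop (Suc j) vs)"
    using props(2,3) j unfolding g_def
    by (metis (no_types, lifting) Cons_nth_drop_Suc distinct.simps(2) distinct_drop le_imp_less_Suc
        add_leE)
  ultimately have "distinct (tl D)" using props by simp
  moreover have "inj_on (\<lambda>x. inv g \<otimes> x) (set (tl D))"
    by (rule inj_on_subset[OF inj_on_translate])
       (use g Dwalk in \<open>auto simp: cayley_walk_def dest: list.set_sel(2)\<close>)
  ultimately have tl_q: "distinct (tl q)" by (simp add: q_def distinct_map flip: map_tl)
  have Dne: "D \<noteq> []" using D by simp
  have ends: "hd q = \<one>" "last q = \<one>"
    unfolding q_def hd_map[OF Dne] last_map[OF Dne] using g Dhd D(1) by simp_all
  obtain w where w: "set w \<subseteq> S" "length q = Suc (length w)"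
    "q = map (\<lambda>x. hd q \<otimes> x) (labelled_walk G w)"
    using walk_is_labelled[OF qwalk] by auto
  have "set (labelled_walk G w) \<subseteq> carrier G"
    using set_labelled_walk w S_closed by blast
  \<comment> \<open>Since \<open>q\<close> starts at the identity, the translation by
    \<open>hd q\<close> is trivial.\<close>
  then have "map (\<lambda>x. \<one> \<otimes> x) (labelled_walk G w) = labelled_walk G w"
    by (intro map_idI) auto
  then have q: "q = labelled_walk G w" using w(3) ends by simp
  have "length q = n + 2 - j" using D by (simp add: q_def)
  then have "w \<in> saps G S (n + 1 - j)"
    using w(1,2) q ends qwalk tl_q j last_labelled_walk[of w]
    by (auto simp: saps_def simple_cycle_def)
  moreover have "take (Suc j) ?ws \<in> saws G S j"
    using walk props j by (intro saw_take) auto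
  moreover have "?ws = glue (take (Suc j) ?ws) (labelled_walk G w)"
  proof -
    have "j < length ?ws" using props j by simp
    from glue_split[OF walk this] show ?thesis
      unfolding g(2) D_def[symmetric] q_def[symmetric] unfolding q .
  qed
  ultimately show ?thesis by force
qed

text \<open>The cases are where the new vertex lands. Backtracking leaves no choice of letter, so
  the second set has at most one list per walk. The range of \<open>j\<close> stops below
  \<open>n - 1\<close>, since a return to vertex \<open>n - 1\<close> is backtracking.\<close>

lemma extensions_subset:
  "extensions n \<subseteq> saws G S (Suc n) \<union> (\<lambda>vs. vs @ [vs ! (n - 1)]) ` saws G S n \<union>
     (\<Union>j<n - 1. (\<lambda>(p, w). glue p (labelled_walk G w)) ` (saws G S j \<times> saps G S (n + 1 - j)))"
proof
  fix ws assume "ws \<in> extensions n"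
  then obtain vs s where ws: "ws = vs @ [last vs \<otimes> s]" and vs: "vs \<in> saws G S n" and s: "s \<in> S"
    by (auto simp: extensions_def)
  have props: "hd vs = \<one>" "length vs = Suc n" "distinct vs" "vs \<noteq> []" "set vs \<subseteq> carrier G"
    using vs by (auto simp: saws_def cayley_walk_def)
  show "ws \<in> saws G S (Suc n) \<union> (\<lambda>vs. vs @ [vs ! (n - 1)]) ` saws G S n \<union>
     (\<Union>j<n - 1. (\<lambda>(p, w). glue p (labelled_walk G w)) ` (saws G S j \<times> saps G S (n + 1 - j)))"
  proof (cases "last vs \<otimes> s \<in> set vs")
    case False
    then have "ws \<in> saws G S (Suc n)"
      using ws props extension_walk[OF vs s] by (auto simp: saws_def)
    then show ?thesis by blast
  next
    case True
    then obtain j where j: "j \<le> n" "last vs \<otimes> s = vs ! j"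
      using props(2) by (metis in_set_conv_nth less_Suc_eq_le)
    have "last vs = vs ! n" using props by (simp add: last_conv_nth)
    \<comment> \<open>Staying at the endpoint would force the letter to be the identity.\<close>
    have "j \<noteq> n"
    proof
      assume "j = n"
      then have "last vs \<otimes> s = last vs" using j \<open>last vs = vs ! n\<close> by simp
      moreover have "last vs \<in> carrier G" using props by auto
      ultimately have "s = \<one>" using s S_closed by (auto simp: r_cancel_one)
      with s one_notin_S show False by simp
    qed
    then consider "j = n - 1" | "j + 2 \<le> n" using j(1) by linarith
    then show ?thesis
    proof cases
      case 1
      then show ?thesis using ws j vs by blast
    next
      case 2
      then have "j < n - 1" by simp
      with closing_extension[OF vs s 2 j(2)] ws show ?thesis by blast
    qed
  qed
qed

text \<open>Union bound for the preceding cover; \<open>j\<close> is the length of the walk to which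
  the polygon is attached. The additive form avoids subtracting counts in the naturals.\<close>

lemma saw_count_recursion:
  "saw_count G S n * card S \<le> saw_count G S (Suc n) + saw_count G S n +
     (\<Sum>j<n - 1. saw_count G S j * sap_count G S (n + 1 - j))"
proof -
  let ?R = "(\<lambda>vs. vs @ [vs ! (n - 1)]) ` saws G S n"
  let ?B = "\<lambda>j. (\<lambda>(p, w). glue p (labelled_walk G w)) ` (saws G S j \<times> saps G S (n + 1 - j))"
  have fin: "finite (?B j)" for j
    by (intro finite_imageI finite_cartesian_product finite_saws finite_saps)
  have "card (extensions n) \<le> card (saws G S (Suc n) \<union> ?R \<union> (\<Union>j<n - 1. ?B j))"
    by (intro card_mono extensions_subset finite_UnI finite_UN_I finite_lessThan fin
        finite_saws finite_imageI)
  also have "\<dots> \<le> card (saws G S (Suc n)) + card ?R + card (\<Union>j<n - 1. ?B j)"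
    by (meson add_right_mono card_Un_le order_trans)
  also have "card (\<Union>j<n - 1. ?B j) \<le> (\<Sum>j<n - 1. card (?B j))"
    by (intro card_UN_le finite_lessThan)
  also have "\<dots> \<le> (\<Sum>j<n - 1. saw_count G S j * sap_count G S (n + 1 - j))"
    unfolding saw_count_def sap_count_def card_cartesian_product[symmetric]
    by (intro sum_mono card_image_le finite_cartesian_product finite_saws finite_saps)
  also have "card ?R \<le> saw_count G S n"
    unfolding saw_count_def by (intro card_image_le finite_saws)
  finally show ?thesis
    by (simp add: card_extensions) (simp add: saw_count_def)
qed

section \<open>Growth of the counts and the bound on the connective constant\<close>

text \<open>Strong induction is used because the recursion involves the counts at all lengths below
  \<open>n - 1\<close>, not just the previous one.\<close>

lemma saw_count_growth:
  assumes "\<beta> > 0"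
    and summable: "summable (\<lambda>n. real (sap_count G S n) * \<beta> powi (1 - int n))"
    and le: "real (card S) - 1 \<ge> \<beta> + (\<Sum>n. real (sap_count G S n) * \<beta> powi (1 - int n))"
  shows "\<beta> * real (saw_count G S n) \<le> real (saw_count G S (Suc n))"
proof (induction n rule: less_induct)
  case (less n)
  define c where "c = (\<lambda>n. real (saw_count G S n))"
  define t where "t = (\<lambda>k. real (sap_count G S k) * \<beta> powi (1 - int k))"
  have t_nonneg: "t k \<ge> 0" for k using \<open>\<beta> > 0\<close> by (simp add: t_def)
  \<comment> \<open>Chains the induction hypothesis over \<open>d\<close> consecutive
    lengths.\<close>
  have power_le: "\<beta> ^ d * c j \<le> c (j + d)" if "j + d \<le> n" for j d
    using that
  proof (induction d)
    case (Suc d)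
    then have "\<beta> * (\<beta> ^ d * c j) \<le> \<beta> * c (j + d)"
      using \<open>\<beta> > 0\<close> by (intro mult_left_mono) auto
    also have "\<dots> \<le> c (Suc (j + d))" using less[of "j + d"] Suc by (simp add: c_def)
    finally show ?case by (simp add: mult.assoc)
  qed simp
  have "(\<Sum>j<n - 1. c j * real (sap_count G S (n + 1 - j))) \<le> (\<Sum>j<n - 1. c n * t (n + 1 - j))"
  proof (rule sum_mono)
    fix j assume "j \<in> {..<n - 1}"
    then have "\<beta> ^ (n - j) * c j \<le> c n" using power_le[of j "n - j"] by simp
    then have "c j \<le> c n * inverse (\<beta> ^ (n - j))" using \<open>\<beta> > 0\<close> by (simp add: field_simps)
    \<comment> \<open>The loss from comparing \<open>c j\<close> with \<open>c n\<close> is exactly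
      the weight of a polygon of length \<open>n + 1 - j\<close>.\<close>
    moreover have "1 - int (n + 1 - j) = - int (n - j)" using \<open>j \<in> _\<close> by auto
    then have "\<beta> powi (1 - int (n + 1 - j)) = inverse (\<beta> ^ (n - j))"
      by (simp only: power_int_minus power_int_of_nat)
    ultimately show "c j * real (sap_count G S (n + 1 - j)) \<le> c n * t (n + 1 - j)"
      unfolding t_def by (metis mult.commute mult.left_commute mult_right_mono of_nat_0_le_iff)
  qed
  also have "\<dots> = c n * (\<Sum>j<n - 1. t (n + 1 - j))" by (simp add: sum_distrib_left)
  \<comment> \<open>Distinct \<open>j\<close> give distinct polygon lengths, so this is a finite
    subsum of the nonnegative series and at most its total.\<close>
  also have "(\<Sum>j<n - 1. t (n + 1 - j)) = sum t ((\<lambda>j. n + 1 - j) ` {..<n - 1})"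
    by (subst sum.reindex) (auto simp: inj_on_def)
  also have "c n * \<dots> \<le> c n * suminf t"
    using summable t_nonneg
    by (intro mult_left_mono sum_le_suminf) (auto simp: c_def t_def)
  finally have bad: "(\<Sum>j<n - 1. c j * real (sap_count G S (n + 1 - j))) \<le> c n * suminf t" .
  have "c n * real (card S) \<le> c (Suc n) + c n + (\<Sum>j<n - 1. c j * real (sap_count G S (n + 1 - j)))"
    using saw_count_recursion[of n, folded of_nat_le_iff[where 'a = real]] by (simp add: c_def)
  moreover have "c n * (\<beta> + suminf t) \<le> c n * (real (card S) - 1)"
    using le by (intro mult_left_mono) (auto simp: c_def t_def)
  ultimately have "\<beta> * c n \<le> c (Suc n)" using bad by (simp add: algebra_simps)
  then show ?case by (simp add: c_def)
qed

end

text \<open>Summability is stated separately because \<open>suminf\<close> has no meaningful value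
  on a divergent series; the inequality in words includes it.\<close>

theorem proposition6p8:
  fixes G :: "('a, 'b) monoid_scheme" and S :: "'a set" and \<beta> :: real
  assumes "group G"
    and "infinite (carrier G)"
    and "S \<subseteq> carrier G"
    and "finite S"
    and "generate G S = carrier G"
    and "\<And>s. s \<in> S \<Longrightarrow> inv\<^bsub>G\<^esub> s \<in> S"
    and "\<one>\<^bsub>G\<^esub> \<notin> S"
    and "\<beta> > 0"
    and "summable (\<lambda>n. real (sap_count G S n) * \<beta> powi (1 - int n))"
    and "real (card S) - 1 \<ge> \<beta> + (\<Sum>n. real (sap_count G S n) * \<beta> powi (1 - int n))"
  shows "connective_constant G S \<ge> \<beta>"
proof -
  interpret cayley_graph G S
    using assms by (intro cayley_graph.intro cayley_graph_axioms.intro)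
  define c where "c = (\<lambda>n. real (saw_count G S n))"
  have below: "\<beta> ^ n \<le> c n" for n
  proof (induction n)
    case 0
    then show ?case by (simp add: c_def saw_count_def saws_0)
  next
    case (Suc n)
    then have "\<beta> * \<beta> ^ n \<le> \<beta> * c n" using \<open>\<beta> > 0\<close> by (intro mult_left_mono) auto
    also have "\<dots> \<le> c (Suc n)" unfolding c_def by (rule saw_count_growth[OF assms(8-10)])
    finally show ?case by simp
  qed
  have "c (m + n) \<le> c m * c n" for m n
    using saw_count_add[of m n] unfolding c_def by (metis of_nat_le_iff of_nat_mult)
  then have "convergent (\<lambda>n. root n (c n))"
    using \<open>\<beta> > 0\<close> below by (rule convergent_root_of_submultiplicative)
  \<comment> \<open>\<open>lim\<close> denotes the limit only for a convergent sequence, so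
    convergence has to be established first.\<close>
  then have "(\<lambda>n. root n (c n)) \<longlonglongrightarrow> connective_constant G S"
    by (simp add: convergent_LIMSEQ_iff connective_constant_def c_def)
  \<comment> \<open>The case \<open>n = 0\<close> is excluded because \<open>root 0\<close> is
    constantly 0.\<close>
  moreover have "\<forall>n\<ge>1. \<beta> \<le> root n (c n)"
  proof (intro allI impI)
    fix n :: nat assume "n \<ge> 1"
    then have "root n (\<beta> ^ n) \<le> root n (c n)" using below[of n] by simp
    with \<open>n \<ge> 1\<close> \<open>\<beta> > 0\<close> show "\<beta> \<le> root n (c n)" by (simp add: real_root_power_cancel)
  qed
  ultimately show ?thesis by (intro LIMSEQ_le_const) auto
qed

end
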